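(* For every integer $r\ge0$, every integer $n\ge0$ and every real $x$ with $1+\lambda x>0$, \[ B^{(r)}_{n,\lambda}(x)=\frac{1}{e_\lambda(x)}(XD+r)_{n,\lambda}\,e_\lambda(x), \] where $e_\lambda(x)=(1+\lambda x)^{1/\lambda}$ is regarded as a function of $x$.
   Context: Let $\lambda$ be a fixed nonzero real number and $r\ge0$ an integer. The degenerate falling factorial is $(x)_{0,\lambda}=1$ and $(x)_{n,\lambda}=x(x-\lambda)\cdots(x-(n-1)\lambda)$ for $n\ge1$. The degenerate exponential is $e_\lambda^{x}(t)=(1+\lambda t)^{x/\lambda}=\sum_{n\ge0}(x)_{n,\lambda}\frac{t^n}{n!}$, and $e_\lambda(t)=e_\lambda^1(t)$. For real $x$ with $1+\lambda x>0$, the fully degenerate $r$-Bell polynomials are defined by the formal power series identity in $t$ \[ \frac{1}{e_\lambda(x)}\,e_\lambda\big(xe_\lambda(t)\big)\,e_\lambda^{r}(t)=\sum_{n\ge0}B^{(r)}_{n,\lambda}(x)\frac{t^n}{n!},\qquad e_\lambda(xe_\lambda(t))=(1+\lambda xe_\lambda(t))^{1/\lambda}. \] On smooth functions of $x$ (on the interval $1+\lambda x>0$), $X$ denotes multiplication by $x$, $D=\frac{d}{dx}$, and $(XD+r)_{n,\lambda}=\prod_{i=0}^{n-1}(XD+r-i\lambda)$ (the identity for $n=0$). *)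

theory Defs
  imports "HOL-Analysis.Analysis"
begin

unbundle no vec_syntax
unbundle fps_syntax

definition deg_ffact :: "real \<Rightarrow> real \<Rightarrow> nat \<Rightarrow> real" where
  "deg_ffact lam x n = (\<Prod>i<n. x - real i * lam)"

(* Real power of a formal power series with positive constant term c:
   F^a = c^a * (1 + (F/c - 1))^a, the last factor being Newton's binomial series
   composed with F/c - 1, which has zero constant term. *)
definition fps_rpow :: "real fps \<Rightarrow> real \<Rightarrow> real fps" where
  "fps_rpow F a =
     fps_const ((F $ 0) powr a) * (fps_binomial a oo (fps_const (1 / F $ 0) * F - 1))"

lemma fps_rpow_nth_0: "fps_rpow F a $ 0 = (F $ 0) powr a"
  by (simp add: fps_rpow_def)

lemma fps_rpow_add:
  assumes "F $ 0 > 0"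
  shows "fps_rpow F (a + b) = fps_rpow F a * fps_rpow F b"
proof -
  have "(fps_const (1 / F $ 0) * F - 1) $ 0 = 0"
    using assms by simp
  then show ?thesis
    by (simp add: fps_rpow_def fps_binomial_add_mult fps_compose_mult_distrib powr_add
        flip: fps_const_mult)
qed

lemma fps_rpow_1:
  assumes "F $ 0 > 0"
  shows "fps_rpow F 1 = F"
proof -
  have "(fps_const (1 / F $ 0) * F - 1) $ 0 = 0"
    using assms by simp
  then have "fps_rpow F 1 = fps_const (F $ 0) * (fps_const (1 / F $ 0) * F)"
    using assms
    by (simp add: fps_rpow_def fps_binomial_1 fps_compose_add_distrib fps_X_fps_compose_startby0)
  also have "\<dots> = fps_const (F $ 0 * (1 / F $ 0)) * F"
    by (simp only: fps_const_mult mult.assoc[symmetric])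
  finally show ?thesis
    using assms by simp
qed

(* The degenerate exponential with exponent a, as a function on 1 + lam * x > 0. *)
definition deg_exp :: "real \<Rightarrow> real \<Rightarrow> real \<Rightarrow> real" where
  "deg_exp lam a x = (1 + lam * x) powr (a / lam)"

(* The degenerate exponential with exponent a, evaluated at a formal power series F
   with 1 + lam * F $ 0 > 0. *)
definition deg_exp_fps :: "real \<Rightarrow> real \<Rightarrow> real fps \<Rightarrow> real fps" where
  "deg_exp_fps lam a F = fps_rpow (1 + fps_const lam * F) (a / lam)"

lemma deg_exp_fps_X:
  assumes "lam \<noteq> 0"
  shows "deg_exp_fps lam a fps_X = Abs_fps (\<lambda>n. deg_ffact lam a n / fact n)"
proof (rule fps_ext)
  fix n
  have "deg_exp_fps lam a fps_X $ n = lam ^ n * ((a / lam) gchoose n)"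
    by (simp add: deg_exp_fps_def fps_rpow_def fps_compose_linear)
  also have "\<dots> = (\<Prod>i<n. lam) * (\<Prod>i<n. a / lam - real i) / fact n"
    by (simp add: gbinomial_prod_rev atLeast0LessThan)
  also have "(\<Prod>i<n. lam) * (\<Prod>i<n. a / lam - real i) = deg_ffact lam a n"
    unfolding deg_ffact_def prod.distrib[symmetric]
    using assms by (intro prod.cong) (auto simp: field_simps)
  finally show "deg_exp_fps lam a fps_X $ n = Abs_fps (\<lambda>n. deg_ffact lam a n / fact n) $ n"
    by simp
qed

definition bell_egf :: "real \<Rightarrow> nat \<Rightarrow> real \<Rightarrow> real fps" where
  "bell_egf lam r x =
     fps_const (1 / deg_exp lam 1 x)
     * deg_exp_fps lam 1 (fps_const x * deg_exp_fps lam 1 fps_X)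
     * deg_exp_fps lam (real r) fps_X"

definition deg_bell :: "real \<Rightarrow> nat \<Rightarrow> nat \<Rightarrow> real \<Rightarrow> real" where
  "deg_bell lam r n x = fact n * bell_egf lam r x $ n"

lemma bell_egf_eq: "bell_egf lam r x = Abs_fps (\<lambda>n. deg_bell lam r n x / fact n)"
  by (rule fps_ext) (simp add: deg_bell_def)

(* Operators act on total functions; since deriv is local, values at points of the open
   set {x. 1 + lam * x > 0} depend only on the restriction of the function to it. *)
definition opX :: "(real \<Rightarrow> real) \<Rightarrow> real \<Rightarrow> real" where
  "opX f = (\<lambda>x. x * f x)"

definition opD :: "(real \<Rightarrow> real) \<Rightarrow> real \<Rightarrow> real" where
  "opD f = deriv f"

definition XD_plus :: "real \<Rightarrow> (real \<Rightarrow> real) \<Rightarrow> real \<Rightarrow> real" where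
  "XD_plus c f = (\<lambda>x. opX (opD f) x + c * f x)"

(* The product over i < n of the operators XD + c - i lam, as a composition; the factors
   commute on smooth functions. *)
primrec XD_ffact :: "real \<Rightarrow> real \<Rightarrow> nat \<Rightarrow> (real \<Rightarrow> real) \<Rightarrow> real \<Rightarrow> real" where
  "XD_ffact lam c 0 = id"
| "XD_ffact lam c (Suc n) = XD_plus (c - real n * lam) \<circ> XD_ffact lam c n"

end

(* Expand e_lam(x e_lam(t)) in powers of u = e_lam(t) - 1. This gives
   e_lam(x e_lam(t)) e_lam^r(t) = sum_k E_k(x) W_k(t)  with  W_k = u^k e_lam^r  and
   E_k(x) = x^k e_lam^(k)(x) / k!, a finite sum in each degree of t. The relations
     (1 + lam t) W_k' = (k + r) W_k + k W_(k-1),   x E_k' = k E_k + (k + 1) E_(k+1)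
   show that (1 + lam t) d/dt and x d/dx + r act in the same way on the sum, and comparing
   coefficients of t^n gives the recursion that defines (XD + r)_(n,lam). *)
theory Submission
  imports Defs
begin

text \<open>Since \<open>b ^ k\<close> vanishes below degree \<open>k\<close>, the inner sums over
  \<open>k \<le> i\<close> may all be extended to \<open>k \<le> n\<close>, after which the two
  summations can be exchanged.\<close>

lemma fps_compose_times_nth:
  fixes F b V :: "'a::field fps"
  assumes "b $ 0 = 0"
  shows "((F oo b) * V) $ n = (\<Sum>k\<le>n. F $ k * (b ^ k * V) $ n)"
proof -
  have "((F oo b) * V) $ n = (\<Sum>i\<le>n. (\<Sum>k\<le>i. F $ k * b ^ k $ i) * V $ (n - i))"
    by (simp add: fps_mult_nth fps_compose_nth atLeast0AtMost)
  also have "\<dots> = (\<Sum>i\<le>n. (\<Sum>k\<le>n. F $ k * b ^ k $ i) * V $ (n - i))"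
    using startsby_zero_power_prefix[OF assms]
    by (intro sum.cong refl arg_cong2[where f = "(*)"] sum.mono_neutral_left) auto
  also have "\<dots> = (\<Sum>k\<le>n. \<Sum>i\<le>n. F $ k * b ^ k $ i * V $ (n - i))"
    unfolding sum_distrib_right by (rule sum.swap)
  also have "\<dots> = (\<Sum>k\<le>n. F $ k * (b ^ k * V) $ n)"
    by (simp add: fps_mult_nth sum_distrib_left mult.assoc atLeast0AtMost)
  finally show ?thesis .
qed

text \<open>On coefficients this is the recursion of the falling factorial: passing from
  \<open>n\<close> to \<open>n + 1\<close> multiplies it by \<open>a - n * lam\<close>.\<close>

lemma deg_exp_fps_X_ode:
  assumes "lam \<noteq> 0"
  shows "(1 + fps_const lam * fps_X) * fps_deriv (deg_exp_fps lam a fps_X)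
    = fps_const a * deg_exp_fps lam a fps_X"
proof (rule fps_ext)
  fix n
  show "((1 + fps_const lam * fps_X) * fps_deriv (deg_exp_fps lam a fps_X)) $ n
    = (fps_const a * deg_exp_fps lam a fps_X) $ n"
    by (cases n) (simp_all add: deg_exp_fps_X[OF assms] deg_ffact_def distrib_right mult.assoc
        field_simps del: of_nat_Suc)
qed

text \<open>This is \<open>E_k\<close>, with the \<open>k\<close>-th derivative of the degenerate
  exponential in closed form.\<close>

definition bell_coord :: "real \<Rightarrow> nat \<Rightarrow> real \<Rightarrow> real" where
  "bell_coord lam k x =
     x ^ k * lam ^ k * ((1 / lam) gchoose k) * (1 + lam * x) powr (1 / lam - real k)"

text \<open>This is \<open>W_k\<close>; divided by \<open>k!\<close> it is the exponential
  generating function of the degenerate \<open>r\<close>-Stirling numbers of the second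
  kind.\<close>

definition bell_basis :: "real \<Rightarrow> nat \<Rightarrow> nat \<Rightarrow> real fps" where
  "bell_basis lam r k = (deg_exp_fps lam 1 fps_X - 1) ^ k * deg_exp_fps lam (real r) fps_X"

lemma deg_exp_fps_X_nth_0: "lam \<noteq> 0 \<Longrightarrow> deg_exp_fps lam a fps_X $ 0 = 1"
  by (simp add: deg_exp_fps_X deg_ffact_def)

lemma bell_basis_nth_eq_0:
  assumes "lam \<noteq> 0" and "n < k"
  shows "bell_basis lam r k $ n = 0"
  using startsby_zero_power_prefix[of "deg_exp_fps lam 1 fps_X - 1" k] assms
  by (simp add: bell_basis_def fps_mult_nth deg_exp_fps_X_nth_0)

lemma deg_exp_fps_compose_nth:
  assumes lam: "lam \<noteq> 0" and x: "1 + lam * x > 0"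
  shows "(deg_exp_fps lam 1 (fps_const x * deg_exp_fps lam 1 fps_X)
      * deg_exp_fps lam (real r) fps_X) $ n
    = (\<Sum>k\<le>n. bell_coord lam k x * bell_basis lam r k $ n)"
proof -
  let ?u = "deg_exp_fps lam 1 fps_X - 1" and ?V = "deg_exp_fps lam (real r) fps_X"
  let ?H = "1 + fps_const lam * (fps_const x * deg_exp_fps lam 1 fps_X)"
  let ?q = "lam * x / (1 + lam * x)"
  have H0: "?H $ 0 = 1 + lam * x"
    using deg_exp_fps_X_nth_0[OF lam] by simp
  \<comment> \<open>The base factors as \<open>(1 + lam * x) * (1 + ?q * ?u)\<close>, so Newton's
    series runs in powers of \<open>?q * ?u\<close>.\<close>
  have base: "fps_const (1 / (1 + lam * x)) * ?H - 1 = fps_const ?q * ?u"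
    using x by (intro fps_ext) (simp add: field_simps add_divide_distrib[symmetric])
  have coord: "(1 + lam * x) powr (1 / lam) * ((1 / lam) gchoose k) * ?q ^ k
      = bell_coord lam k x" for k
    using x by (simp add: bell_coord_def powr_diff powr_realpow power_divide power_mult_distrib)
  have "(deg_exp_fps lam 1 (fps_const x * deg_exp_fps lam 1 fps_X) * ?V) $ n
    = (1 + lam * x) powr (1 / lam) * ((fps_binomial (1 / lam) oo (fps_const ?q * ?u)) * ?V) $ n"
    unfolding deg_exp_fps_def[of lam 1 "fps_const x * _"] fps_rpow_def H0 base mult.assoc
      fps_mult_left_const_nth ..
  also have "\<dots> = (\<Sum>k\<le>n. (1 + lam * x) powr (1 / lam) * ((1 / lam) gchoose k) * ?q ^ k
      * bell_basis lam r k $ n)"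
    using deg_exp_fps_X_nth_0[OF lam]
    by (subst fps_compose_times_nth)
      (simp_all add: sum_distrib_left power_mult_distrib bell_basis_def mult.assoc
        fps_const_power del: fps_const_sub)
  finally show ?thesis
    by (simp only: coord)
qed

text \<open>In the product rule, differentiating \<open>u ^ k\<close> produces a factor
  \<open>e = u + 1\<close>: its part \<open>u\<close> restores \<open>W_k\<close>, its part
  \<open>1\<close> leaves \<open>W_(k-1)\<close>. At \<open>k = 0\<close> the truncated index
  \<open>k - 1\<close> is harmless, as its coefficient is zero.\<close>

lemma bell_basis_ode:
  assumes "lam \<noteq> 0"
  shows "(1 + fps_const lam * fps_X) * fps_deriv (bell_basis lam r k)
    = fps_const (real k + real r) * bell_basis lam r k
      + fps_const (real k) * bell_basis lam r (k - 1)"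
proof -
  let ?L = "1 + fps_const lam * fps_X"
  let ?e = "deg_exp_fps lam 1 fps_X" and ?V = "deg_exp_fps lam (real r) fps_X"
  have e: "?L * fps_deriv ?e = ?e"
    using deg_exp_fps_X_ode[OF assms, of 1] by simp
  have V: "?L * fps_deriv ?V = fps_const (real r) * ?V"
    by (rule deg_exp_fps_X_ode[OF assms])
  have "?L * fps_deriv (bell_basis lam r k)
    = fps_const (real k) * (?e - 1) ^ (k - 1) * ?V * (?L * fps_deriv ?e)
      + (?e - 1) ^ k * (?L * fps_deriv ?V)"
    by (simp add: bell_basis_def fps_deriv_power algebra_simps)
  also have "\<dots> = fps_const (real k) * (?e - 1) ^ (k - 1) * ?V * ((?e - 1) + 1)
      + (?e - 1) ^ k * (fps_const (real r) * ?V)"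
    unfolding e V by simp
  also have "\<dots> = fps_const (real k) * ((?e - 1) * (?e - 1) ^ (k - 1)) * ?V
      + fps_const (real k) * bell_basis lam r (k - 1) + fps_const (real r) * bell_basis lam r k"
    unfolding bell_basis_def by (simp only: algebra_simps mult_1_left mult_1_right)
  also have "fps_const (real k) * ((?e - 1) * (?e - 1) ^ (k - 1)) * ?V
      = fps_const (real k) * bell_basis lam r k"
    by (cases k) (simp_all add: bell_basis_def)
  finally show ?thesis
    by (simp only: fps_const_add[symmetric] algebra_simps)
qed

text \<open>The term \<open>lam * t\<close> of the factor \<open>1 + lam * t\<close> contributes the
  shift \<open>- n * lam\<close> of the operator falling factorial.\<close>

lemma bell_basis_nth_Suc:
  assumes "lam \<noteq> 0"
  shows "real (Suc n) * bell_basis lam r k $ Suc n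
    = (real k + real r - real n * lam) * bell_basis lam r k $ n
      + real k * bell_basis lam r (k - 1) $ n"
proof -
  have "((1 + fps_const lam * fps_X) * fps_deriv (bell_basis lam r k)) $ n
      = real (Suc n) * bell_basis lam r k $ Suc n + lam * real n * bell_basis lam r k $ n"
    by (cases n) (simp_all add: distrib_right mult.assoc)
  then show ?thesis
    unfolding bell_basis_ode[OF assms] by (simp add: algebra_simps)
qed

lemma bell_coord_deriv:
  assumes "1 + lam * x > 0"
  shows "\<exists>d. (bell_coord lam k has_field_derivative d) (at x) \<and>
    x * d = real k * bell_coord lam k x + real (Suc k) * bell_coord lam (Suc k) x"
proof (intro exI conjI)
  let ?c = "1 + lam * x" and ?a = "1 / lam"
  let ?d = "lam ^ k * (?a gchoose k) * (real k * x ^ (k - 1) * ?c powr (?a - real k)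
    + x ^ k * ((?a - real k) * ?c powr (?a - real k - 1) * lam))"
  have "((\<lambda>x. x ^ k * lam ^ k * (?a gchoose k) * (1 + lam * x) powr (?a - real k))
      has_field_derivative ?d) (at x)"
    using assms by (auto intro!: derivative_eq_intros simp: algebra_simps)
  then show "(bell_coord lam k has_field_derivative ?d) (at x)"
    unfolding bell_coord_def[abs_def] .
  have k: "x * (real k * x ^ (k - 1)) = real k * x ^ k"
    by (cases k) simp_all
  \<comment> \<open>The factor \<open>?a - k\<close> released by differentiating the power advances
    the binomial coefficient from \<open>k\<close> to \<open>k + 1\<close>.\<close>
  have g: "real (Suc k) * (?a gchoose Suc k) = (?a - real k) * (?a gchoose k)"
    using gbinomial_mult_1[of ?a k] by (simp add: algebra_simps)
  have "x * ?d = lam ^ k * (?a gchoose k) * (x * (real k * x ^ (k - 1))) * ?c powr (?a - real k)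
      + x ^ Suc k * lam ^ Suc k * ((?a - real k) * (?a gchoose k)) * ?c powr (?a - real (Suc k))"
    by (simp add: algebra_simps)
  then show "x * ?d = real k * bell_coord lam k x + real (Suc k) * bell_coord lam (Suc k) x"
    unfolding k g[symmetric] bell_coord_def by (simp only: mult_ac)
qed

lemma XD_ffact_deg_exp:
  assumes lam: "lam \<noteq> 0" and x: "1 + lam * x > 0"
  shows "XD_ffact lam (real r) n (deg_exp lam 1) x
    = fact n * (\<Sum>k\<le>n. bell_coord lam k x * bell_basis lam r k $ n)"
  using x
proof (induction n arbitrary: x)
  case 0
  then show ?case
    by (simp add: bell_coord_def bell_basis_def deg_exp_def deg_exp_fps_X_nth_0[OF lam])
next
  case (Suc n)
  let ?E = "bell_coord lam" and ?W = "bell_basis lam r"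
  define d where "d k = deriv (?E k) x" for k
  have d: "(?E k has_field_derivative d k) (at x)"
    "x * d k = real k * ?E k x + real (Suc k) * ?E (Suc k) x" for k
    using bell_coord_deriv[OF Suc.prems, of k] unfolding d_def by (auto dest: DERIV_imp_deriv)
  \<comment> \<open>Differentiating the induction hypothesis requires it on a whole neighbourhood of
    \<open>x\<close>, hence the induction with \<open>x\<close> arbitrary.\<close>
  have "open {y. 0 < 1 + lam * y}"
    by (intro open_Collect_less continuous_intros)
  then have "\<forall>\<^sub>F y in nhds x. 0 < 1 + lam * y"
    using Suc.prems eventually_nhds by blast
  then have ev: "\<forall>\<^sub>F y in nhds x. XD_ffact lam (real r) n (deg_exp lam 1) y
      = fact n * (\<Sum>k\<le>n. ?E k y * ?W k $ n)"
    by eventually_elim (rule Suc.IH)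
  have "((\<lambda>y. fact n * (\<Sum>k\<le>n. ?E k y * ?W k $ n)) has_field_derivative
      fact n * (\<Sum>k\<le>n. d k * ?W k $ n)) (at x)"
    by (intro DERIV_cmult DERIV_sum DERIV_cmult_right d)
  then have D: "deriv (XD_ffact lam (real r) n (deg_exp lam 1)) x
      = fact n * (\<Sum>k\<le>n. d k * ?W k $ n)"
    using deriv_cong_ev[OF ev refl] by (simp add: DERIV_imp_deriv)
  \<comment> \<open>The summand at \<open>k = 0\<close> is zero, so the index moves down by
    one.\<close>
  have shift: "(\<Sum>k\<le>Suc n. ?E k x * (real k * ?W (k - 1) $ n))
      = (\<Sum>k\<le>n. real (Suc k) * ?E (Suc k) x * ?W k $ n)"
    by (subst sum.atMost_Suc_shift) (simp add: mult_ac del: of_nat_Suc sum.atMost_Suc)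
  have "fact (Suc n) * (\<Sum>k\<le>Suc n. ?E k x * ?W k $ Suc n)
      = fact n * (\<Sum>k\<le>Suc n. ?E k x * (real (Suc n) * ?W k $ Suc n))"
    by (simp only: fact_Suc sum_distrib_left of_nat_mult mult_ac)
  also have "\<dots> = fact n * ((\<Sum>k\<le>Suc n. ?E k x * ((real k + real r - real n * lam) * ?W k $ n))
      + (\<Sum>k\<le>Suc n. ?E k x * (real k * ?W (k - 1) $ n)))"
    unfolding bell_basis_nth_Suc[OF lam] by (simp only: distrib_left sum.distrib)
  \<comment> \<open>The top term drops out because \<open>W_(n+1)\<close> has no coefficient in
    degree \<open>n\<close>.\<close>
  also have "(\<Sum>k\<le>Suc n. ?E k x * ((real k + real r - real n * lam) * ?W k $ n))
      = (\<Sum>k\<le>n. ?E k x * ((real k + real r - real n * lam) * ?W k $ n))"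
    by (simp add: bell_basis_nth_eq_0[OF lam])
  \<comment> \<open>By \<open>d(2)\<close>, \<open>k * E_k\<close> and the shifted
    \<open>(k + 1) * E_(k+1)\<close> combine to \<open>x * d k\<close>; what remains is
    \<open>r - n * lam\<close>, the scalar part of the next operator factor.\<close>
  also have "fact n * (\<dots> + (\<Sum>k\<le>Suc n. ?E k x * (real k * ?W (k - 1) $ n)))
      = fact n * (\<Sum>k\<le>n. x * d k * ?W k $ n + (real r - real n * lam) * (?E k x * ?W k $ n))"
    unfolding shift sum.distrib[symmetric] d(2) by (simp only: algebra_simps)
  also have "\<dots> = XD_ffact lam (real r) (Suc n) (deg_exp lam 1) x"
    by (simp add: XD_plus_def opX_def opD_def D Suc.IH[OF Suc.prems] sum.distrib sum_subtractf
        sum_distrib_left algebra_simps)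
  finally show ?case ..
qed

theorem theorem2p11:
  fixes lam x :: real and r n :: nat
  assumes "lam \<noteq> 0" and "1 + lam * x > 0"
  shows "deg_bell lam r n x = 1 / deg_exp lam 1 x * XD_ffact lam (real r) n (deg_exp lam 1) x"
  unfolding deg_bell_def bell_egf_def mult.assoc fps_mult_left_const_nth
    deg_exp_fps_compose_nth[OF assms] XD_ffact_deg_exp[OF assms]
  by (simp only: mult_ac)

end
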